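(* For every integer $n \geq 1$, the set $U_n$ of Ulam polynomials of degree $n$, regarded as the subset $\{(x_1,\dots,x_n) \in \mathbb{C}^n : T_n(x_1,\dots,x_n) = (x_1,\dots,x_n)\}$ of $\mathbb{C}^n$, is finite.
   Context: For an integer $n \geq 1$, let $T_n : \mathbb{C}^n \to \mathbb{C}^n$ be the map $T_n(x_1,\dots,x_n) = (x'_1,\dots,x'_n)$ with $x'_j = (-1)^j \sigma_j(x_1,\dots,x_n)$ for $j = 1,\dots,n$, where $\sigma_j$ is the $j$th elementary symmetric function in $n$ variables. Equivalently, $x'_1,\dots,x'_n$ are the coefficients determined by the polynomial identity $z^n + x'_1 z^{n-1} + \cdots + x'_{n-1} z + x'_n = (z-x_1)(z-x_2)\cdots(z-x_n)$. A monic polynomial $P \in \mathbb{C}[z]$ of degree $n$ is called a Ulam polynomial if its roots are a fixed point of $T_n$, i.e. $P(z) = (z-x_1)\cdots(z-x_n)$ with $T_n(x_1,\dots,x_n) = (x_1,\dots,x_n)$; in other words $P(z) = z^n + x_1 z^{n-1} + \cdots + x_{n-1} z + x_n = (z-x_1)\cdots(z-x_n)$. The set of Ulam polynomials of degree $n$ is denoted $U_n$; it is regarded as a subset of $\mathbb{C}^n$ by identifying such a $P$ with the point $(x_1,\dots,x_n)$. *)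

theory Defs
  imports Complex_Main "HOL-Library.FuncSet" "HOL-Computational_Algebra.Polynomial"
begin

definition elem_sym :: "nat \<Rightarrow> nat \<Rightarrow> (nat \<Rightarrow> complex) \<Rightarrow> complex" where
  "elem_sym n j x = (\<Sum>S | S \<subseteq> {1..n} \<and> card S = j. \<Prod>i\<in>S. x i)"

(* A point of C^n is an element of {1..n} ->E UNIV: a function on nat that is
   undefined outside {1..n}, so that the points are exactly the n-tuples
   (x 1, ..., x n). *)
definition cspace :: "nat \<Rightarrow> (nat \<Rightarrow> complex) set" where
  "cspace n = {1..n} \<rightarrow>\<^sub>E UNIV"

definition ulam_map :: "nat \<Rightarrow> (nat \<Rightarrow> complex) \<Rightarrow> (nat \<Rightarrow> complex)" where
  "ulam_map n x = (\<lambda>j\<in>{1..n}. (-1) ^ j * elem_sym n j x)"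

definition ulam_set :: "nat \<Rightarrow> (nat \<Rightarrow> complex) set" where
  "ulam_set n = {x \<in> cspace n. ulam_map n x = x}"

lemma ulam_map_in_cspace: "ulam_map n x \<in> cspace n"
  by (simp add: ulam_map_def cspace_def)

(* The equivalent description of the map by the polynomial identity
   z^n + x'_1 z^(n-1) + ... + x'_n = (z - x_1) ... (z - x_n). *)
lemma ulam_map_coeffs:
  "monom 1 n + (\<Sum>j=1..n. monom (ulam_map n x j) (n - j)) = (\<Prod>i=1..n. [:- x i, 1:])"
proof -
  let ?P = "\<lambda>j. {S. S \<subseteq> {1..n} \<and> card S = j}"
  have fin: "finite (?P j)" for j
    by (rule finite_subset[of _ "Pow {1..n}"]) auto
  have lin: "[:- x i, 1:] = monom 1 1 - [:x i:]" for i
    by (simp add: monom_Suc)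
  have cst: "(\<Prod>i\<in>A. [:x i:]) = [:\<Prod>i\<in>A. x i:]" for A
    by (induction A rule: infinite_finite_induct) (auto simp: one_pCons)
  have sgn: "(-1::complex poly) ^ k = [:(-1) ^ k:]" for k
    by (induction k) (auto simp: one_pCons)
  have Un: "Pow {1..n} = (\<Union>j\<in>{0..n}. ?P j)"
    using card_mono[of "{1..n}"] by auto
  have "(\<Prod>i=1..n. [:- x i, 1:]) =
      (\<Sum>S\<in>Pow {1..n}. (-1) ^ card S * (\<Prod>i\<in>S. [:x i:]) * (\<Prod>i\<in>{1..n} - S. monom 1 1))"
    unfolding lin by (rule prod_diff_conv_sum) simp
  also have "\<dots> = (\<Sum>S\<in>Pow {1..n}. monom ((-1) ^ card S * (\<Prod>i\<in>S. x i)) (n - card S))"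
    by (intro sum.cong refl)
       (auto simp: cst sgn monom_power smult_monom mult.commute card_Diff_subset finite_subset[of _ "{1..n}"])
  also have "\<dots> = (\<Sum>j=0..n. \<Sum>S\<in>?P j. monom ((-1) ^ card S * (\<Prod>i\<in>S. x i)) (n - card S))"
    unfolding Un by (rule sum.UNION_disjoint) (use fin in auto)
  also have "\<dots> = (\<Sum>j=0..n. monom ((-1) ^ j * elem_sym n j x) (n - j))"
    by (intro sum.cong refl) (simp add: elem_sym_def sum_distrib_left monom_sum)
  also have "\<dots> = monom (elem_sym n 0 x) n + (\<Sum>j=1..n. monom (ulam_map n x j) (n - j))"
    by (simp add: sum.atLeast_Suc_atMost ulam_map_def)
  also have "elem_sym n 0 x = 1"
  proof -
    have "?P 0 = {{}}"
      by (auto dest: finite_subset)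
    then show ?thesis by (simp add: elem_sym_def)
  qed
  finally show ?thesis by simp
qed

end

theory Submission
  imports Defs "HOL-Library.Function_Algebras"
begin

text \<open>
  If \<open>x\<close> is a fixed point, then each coordinate \<open>x\<^sub>i\<close> is a root of the polynomial with coefficients
  \<open>x\<^sub>1, \<dots>, x\<^sub>n\<close>, that is, \<open>x\<^sub>i\<^sup>n + x\<^sub>1 x\<^sub>i\<^sup>n\<^sup>-\<^sup>1 + \<dots> + x\<^sub>n = 0\<close>. Modulo polynomials of lower total degree
  this says \<open>x\<^sub>i\<^sup>n = - x\<^sub>1 x\<^sub>i\<^sup>n\<^sup>-\<^sup>1\<close>. For \<open>i = 1\<close> the leading form \<open>2 x\<^sub>1\<^sup>n\<close> vanishes, and hence so does
  the leading form \<open>x\<^sub>i\<^sup>2\<^sup>n\<^sup>-\<^sup>1\<close> for every \<open>i\<close>. So on the set of fixed points every monomial of large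
  degree is a combination of monomials of smaller degree, and the polynomial functions on this set
  form a finite-dimensional space. The powers of each coordinate function are then linearly
  dependent, so each coordinate takes only finitely many values.
\<close>

interpretation fun_space: vector_space "\<lambda>(c::complex) (f::'a \<Rightarrow> complex) x. c * f x"
  by unfold_locales (auto simp: algebra_simps fun_eq_iff)

lemma sum_fun_apply: "(\<Sum>i\<in>A. f i) x = (\<Sum>i\<in>A. f i x :: complex)"
  by (induction A rule: infinite_finite_induct) auto

lemma finite_image_if_powers_in_finite_span:
  fixes h :: "'a \<Rightarrow> complex"
  assumes "finite B"
    and span: "\<And>k. (\<lambda>x. if x \<in> V then h x ^ k else 0) \<in> fun_space.span B"
  shows "finite (h ` V)"
proof -
  define g where "g k = (\<lambda>x. if x \<in> V then h x ^ k else 0)" for k :: nat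
  define K where "K = {..card B}"
  have "\<exists>p. p \<noteq> 0 \<and> (\<forall>x\<in>V. poly p (h x) = 0)"
  proof (cases "inj_on g K")
    case False
    then obtain a b where ab: "a \<noteq> b" "g a = g b"
      by (auto simp: inj_on_def)
    let ?p = "monom 1 a - monom 1 b :: complex poly"
    have "coeff ?p a \<noteq> 0"
      using ab by simp
    then have "?p \<noteq> 0"
      by force
    moreover have "poly ?p (h x) = 0" if "x \<in> V" for x
      using fun_cong[OF ab(2), of x] that by (simp add: g_def poly_monom)
    ultimately show ?thesis
      by blast
  next
    case True
    then have "card (g ` K) = Suc (card B)"
      by (simp add: card_image K_def)
    then have "fun_space.dependent (g ` K)"
      using fun_space.independent_span_bound[OF \<open>finite B\<close>, of "g ` K"] span
      by (auto simp: g_def)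
    then obtain u k where k: "k \<in> K" "u (g k) \<noteq> 0"
      and u: "(\<Sum>v\<in>g ` K. (\<lambda>x. u v * v x)) = 0"
      using fun_space.dependent_finite[of "g ` K"] by (auto simp: K_def)
    let ?p = "\<Sum>k\<in>K. monom (u (g k)) k"
    have "coeff ?p k = u (g k)"
      using k by (simp add: coeff_sum K_def)
    with k have "?p \<noteq> 0"
      by force
    moreover have "poly ?p (h x) = 0" if "x \<in> V" for x
    proof -
      have "poly ?p (h x) = (\<Sum>k\<in>K. u (g k) * g k x)"
        using that by (simp add: poly_sum poly_monom g_def)
      also have "\<dots> = (\<Sum>v\<in>g ` K. (\<lambda>x. u v * v x)) x"
        by (simp add: sum.reindex[OF True] sum_fun_apply)
      finally show ?thesis
        by (simp add: u)
    qed
    ultimately show ?thesis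
      by blast
  qed
  then obtain p where p: "p \<noteq> 0" "\<forall>x\<in>V. poly p (h x) = 0"
    by blast
  then have "h ` V \<subseteq> {z. poly p z = 0}"
    by blast
  then show ?thesis
    using poly_roots_finite[OF p(1)] finite_subset by blast
qed

text \<open>The exponent vector of the pure power \<open>x_i^k\<close>.\<close>

definition single :: "nat \<Rightarrow> nat \<Rightarrow> nat \<Rightarrow> nat" where
  "single i k = (\<lambda>j. if j = i then k else 0)"

lemma single_add: "single i k + single i l = single i (k + l)"
  by (auto simp: single_def)

locale self_rooted =
  fixes n :: nat and V :: "(nat \<Rightarrow> complex) set"
  assumes n_pos: "n \<ge> 1"
    and root: "\<And>x i. x \<in> V \<Longrightarrow> i \<in> {1..n} \<Longrightarrow> x i ^ n + (\<Sum>j=1..n. x j * x i ^ (n - j)) = 0"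
begin

text \<open>Extension by zero off \<open>V\<close> makes an equation between such functions an
  identity on \<open>V\<close> only.\<close>

definition mon :: "(nat \<Rightarrow> nat) \<Rightarrow> (nat \<Rightarrow> complex) \<Rightarrow> complex" where
  "mon e = (\<lambda>x. if x \<in> V then \<Prod>i=1..n. x i ^ e i else 0)"

definition deg :: "(nat \<Rightarrow> nat) \<Rightarrow> nat" where
  "deg e = (\<Sum>i=1..n. e i)"

text \<open>Working modulo \<open>low d\<close> replaces taking leading forms of degree
  \<open>d\<close>.\<close>

definition low :: "nat \<Rightarrow> ((nat \<Rightarrow> complex) \<Rightarrow> complex) set" where
  "low d = fun_space.span (mon ` {e. deg e < d})"

lemma mon_add: "mon (e + f) = mon e * mon f"
  by (auto simp: mon_def fun_eq_iff power_add prod.distrib)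

lemma deg_add: "deg (e + f) = deg e + deg f"
  by (simp add: deg_def sum.distrib)

lemma mon_single: "i \<in> {1..n} \<Longrightarrow> mon (single i k) = (\<lambda>x. if x \<in> V then x i ^ k else 0)"
  by (auto simp: mon_def single_def fun_eq_iff power_0 if_distrib[of "(^) _"] cong: if_cong)

lemma deg_single: "i \<in> {1..n} \<Longrightarrow> deg (single i k) = k"
  by (simp add: deg_def single_def)

lemma mon_in_low: "deg e < d \<Longrightarrow> mon e \<in> low d"
  by (auto simp: low_def intro: fun_space.span_base)

text \<open>Multiply the root equation for \<open>x i\<close> by the monomial of \<open>r\<close>:
  the terms \<open>x j * x i ^ (n - j)\<close> with j \<ge> 2 have degree below
  \<open>n\<close>.\<close>

lemma mon_replace:
  assumes i: "i \<in> {1..n}"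
  shows "mon (r + single i n) + mon (r + single i (n - 1) + single 1 1) \<in> low (deg r + n)"
proof -
  have "mon (r + single i n) + mon (r + single i (n - 1) + single 1 1) =
      - (\<Sum>j=2..n. mon (r + single i (n - j) + single j 1))" (is "?lhs = ?rhs")
  proof
    fix x
    show "?lhs x = ?rhs x"
    proof (cases "x \<in> V")
      case True
      have "(\<Sum>j=1..n. x j * x i ^ (n - j)) = x 1 * x i ^ (n - 1) + (\<Sum>j=2..n. x j * x i ^ (n - j))"
        using n_pos by (simp add: sum.atLeast_Suc_atMost numeral_2_eq_2)
      with root[OF True i] have "x i ^ n + x 1 * x i ^ (n - 1) = - (\<Sum>j=2..n. x j * x i ^ (n - j))"
        by (simp add: eq_neg_iff_add_eq_0 add.assoc)
      then have "mon r x * (x i ^ n + x 1 * x i ^ (n - 1)) =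
          - (\<Sum>j=2..n. mon r x * (x j * x i ^ (n - j)))"
        by (simp add: sum_distrib_left)
      moreover have "(\<Sum>j=2..n. mon r x * (x j * x i ^ (n - j))) =
          (\<Sum>j=2..n. mon (r + single i (n - j) + single j 1) x)"
        using True i by (intro sum.cong) (auto simp: mon_add mon_single)
      moreover have "?lhs x = mon r x * (x i ^ n + x 1 * x i ^ (n - 1))"
        using True i n_pos by (simp add: mon_add mon_single distrib_left mult.commute)
      ultimately show ?thesis
        by (simp only: sum_fun_apply uminus_apply)
    qed (auto simp: mon_def sum_fun_apply)
  qed
  also have "\<dots> \<in> low (deg r + n)"
    unfolding low_def
    by (intro fun_space.span_neg fun_space.span_sum mon_in_low[unfolded low_def])
       (use i in \<open>auto simp: deg_add deg_single\<close>)
  finally show ?thesis .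
qed

text \<open>For \<open>i = 1\<close> the two monomials in \<open>mon_replace\<close> coincide, so
  half of their sum is the claim.\<close>

lemma mon_first_power_in_low: "mon (r + single 1 n) \<in> low (deg r + n)"
proof -
  have "r + single 1 (n - 1) + single 1 1 = r + single 1 n"
    using n_pos by (simp add: add.assoc single_add)
  then have "mon (r + single 1 n) + mon (r + single 1 n) \<in> low (deg r + n)"
    using mon_replace[of 1 r] n_pos by simp
  then have "(\<lambda>x. 1 / 2 * (mon (r + single 1 n) + mon (r + single 1 n)) x) \<in> low (deg r + n)"
    unfolding low_def by (rule fun_space.span_scale)
  then show ?thesis
    by simp
qed

text \<open>Starting from a multiple of \<open>x_1^n\<close>, each step trades one factor
  \<open>x_1\<close> for \<open>x_i\<close> by \<open>mon_replace\<close>, up to sign and lower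
  terms; \<open>k = n\<close> leaves the pure power \<open>x_i^(2n-1)\<close>.\<close>

lemma mon_mixed_power_in_low:
  assumes i: "i \<in> {1..n}" and "k \<le> n"
  shows "mon (r + single 1 (n - k) + single i (n - 1 + k)) \<in> low (deg r + (2 * n - 1))"
  using \<open>k \<le> n\<close>
proof (induction k)
  case 0
  have "r + single 1 (n - 0) + single i (n - 1 + 0) = (r + single i (n - 1)) + single 1 n"
    by (simp add: add_ac)
  moreover have "deg (r + single i (n - 1)) + n = deg r + (2 * n - 1)"
    using i n_pos by (simp add: deg_add deg_single)
  ultimately show ?case
    using mon_first_power_in_low[of "r + single i (n - 1)"] by (simp only:)
next
  case (Suc k)
  \<comment> \<open>The cofactor for which the two monomials of \<open>mon_replace\<close> are those
    for \<open>Suc k\<close> and \<open>k\<close>.\<close>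
  define q where "q = r + single 1 (n - Suc k) + single i k"
  have n1: "1 \<in> {1..n}"
    using n_pos by simp
  have "deg q + n = deg r + (2 * n - 1)"
    using Suc.prems i n1 by (simp add: q_def deg_add deg_single)
  moreover have "q + single i n = r + single 1 (n - Suc k) + single i (n - 1 + Suc k)"
    using n_pos by (simp add: q_def add.assoc single_add add.commute[of k])
  moreover have "q + single i (n - 1) + single 1 1 = r + single 1 (n - k) + single i (n - 1 + k)"
    using Suc.prems by (auto simp: q_def fun_eq_iff single_def)
  ultimately have
    "mon (r + single 1 (n - Suc k) + single i (n - 1 + Suc k)) +
      mon (r + single 1 (n - k) + single i (n - 1 + k)) \<in> low (deg r + (2 * n - 1))"
    using mon_replace[OF i, of q] by (simp only:)
  moreover have "mon (r + single 1 (n - k) + single i (n - 1 + k)) \<in> low (deg r + (2 * n - 1))"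
    using Suc.IH Suc.prems by (meson Suc_leD)
  ultimately show ?case
    unfolding low_def using fun_space.span_diff[of "_ + _"] by (metis add_diff_cancel_right')
qed

lemma mon_large_power_in_low:
  assumes i: "i \<in> {1..n}" and "e i \<ge> 2 * n - 1"
  shows "mon e \<in> low (deg e)"
proof -
  define r where "r = e(i := e i - (2 * n - 1))"
  \<comment> \<open>The trivial factor with exponent \<open>n - n\<close> matches the case
    \<open>k = n\<close> of the previous lemma.\<close>
  have e: "e = r + single 1 (n - n) + single i (n - 1 + n)"
    using assms by (auto simp: r_def fun_eq_iff single_def)
  have "deg e = deg r + (2 * n - 1)"
    using i n_pos by (subst e) (simp add: deg_add deg_single)
  then show ?thesis
    using mon_mixed_power_in_low[OF i order_refl, of r] e by simp
qed

text \<open>Above this bound some exponent reaches \<open>2 * n - 1\<close> by pigeonhole, so the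
  degree can be lowered repeatedly.\<close>

lemma mon_in_span_bounded_degree:
  "mon e \<in> fun_space.span (mon ` {f. deg f \<le> n * (2 * n - 1)})"
proof (induction "deg e" arbitrary: e rule: less_induct)
  case less
  show ?case
  proof (cases "deg e \<le> n * (2 * n - 1)")
    case True
    then show ?thesis
      by (auto intro: fun_space.span_base)
  next
    case False
    have "\<exists>i\<in>{1..n}. e i \<ge> 2 * n - 1"
    proof (rule ccontr)
      assume "\<not> ?thesis"
      then have "deg e \<le> card {1..n} * (2 * n - 1)"
        unfolding deg_def using sum_bounded_above[of "{1..n}" e "2 * n - 1"] by force
      with False show False
        by simp
    qed
    then have "mon e \<in> low (deg e)"
      using mon_large_power_in_low by blast
    also have "low (deg e) \<subseteq> fun_space.span (mon ` {f. deg f \<le> n * (2 * n - 1)})"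
      unfolding low_def by (rule fun_space.span_minimal) (use less in auto)
    finally show ?thesis .
  qed
qed

lemma finite_mon_bounded_degree: "finite (mon ` {e. deg e \<le> d})"
proof (rule finite_subset)
  \<comment> \<open>Neither \<open>mon\<close> nor \<open>deg\<close> sees exponents outside
    \<open>{1..n}\<close>, so infinitely many \<open>e\<close> qualify; restricting them leaves
    finitely many.\<close>
  show "mon ` {e. deg e \<le> d} \<subseteq> mon ` ({1..n} \<rightarrow>\<^sub>E {..d})"
  proof (rule image_subsetI)
    fix e assume "e \<in> {e. deg e \<le> d}"
    then have "e i \<le> d" if "i \<in> {1..n}" for i
      using member_le_sum[of i "{1..n}" e] that by (auto simp: deg_def)
    then have "restrict e {1..n} \<in> {1..n} \<rightarrow>\<^sub>E {..d}"
      by auto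
    moreover have "mon e = mon (restrict e {1..n})"
      by (auto simp: mon_def)
    ultimately show "mon e \<in> mon ` ({1..n} \<rightarrow>\<^sub>E {..d})"
      by blast
  qed
qed (auto intro: finite_PiE)

lemma finite_coordinate_values: "i \<in> {1..n} \<Longrightarrow> finite ((\<lambda>x. x i) ` V)"
  using mon_in_span_bounded_degree[of "single i _"]
  by (intro finite_image_if_powers_in_finite_span[OF finite_mon_bounded_degree])
     (simp add: mon_single)

end

text \<open>Evaluate the polynomial identity at \<open>x i\<close>, where the product has a zero
  factor.\<close>

lemma ulam_set_root:
  assumes "x \<in> ulam_set n" "i \<in> {1..n}"
  shows "x i ^ n + (\<Sum>j=1..n. x j * x i ^ (n - j)) = 0"
proof -
  have "ulam_map n x = x"
    using assms by (simp add: ulam_set_def)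
  then have "monom 1 n + (\<Sum>j=1..n. monom (x j) (n - j)) = (\<Prod>i=1..n. [:- x i, 1:])"
    using ulam_map_coeffs[of n x] by simp
  then have "poly (monom 1 n + (\<Sum>j=1..n. monom (x j) (n - j))) (x i) =
      poly (\<Prod>i=1..n. [:- x i, 1:]) (x i)"
    by (rule arg_cong)
  also have "\<dots> = 0"
    using assms(2) by (auto simp: poly_prod)
  finally show ?thesis
    by (simp add: poly_sum poly_monom)
qed

theorem theorem1p1:
  fixes n :: nat
  assumes "n \<ge> 1"
  shows "finite (ulam_set n)"
proof -
  interpret self_rooted n "ulam_set n"
    using assms ulam_set_root by unfold_locales
  \<comment> \<open>Points are undefined outside \<open>{1..n}\<close>, hence determined by their
    \<open>n\<close> coordinates.\<close>
  have "ulam_set n \<subseteq> (\<Pi>\<^sub>E i\<in>{1..n}. (\<lambda>x. x i) ` ulam_set n)"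
    unfolding ulam_set_def cspace_def by blast
  then show ?thesis
    using finite_PiE[of "{1..n}" "\<lambda>i. (\<lambda>x. x i) ` ulam_set n"] finite_coordinate_values finite_subset
    by blast
qed

end
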